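(* Suppose $M:=\sum_{t=0}^\infty\big(\sup_{i\in\mathcal S,u\in U}|f(t,i,u)|+\delta(t)\big)<\infty$. For any $\lambda>0$ and $\pi\in\Pi_r$, $$\pi\text{ is a regular relaxed equilibrium for }J_\lambda\iff\Phi_\lambda(\pi)=\pi.$$
   Context: Setting (discrete time). $\mathbb N_0=\mathbb N\cup\{0\}$. Fix $\ell,d\in\mathbb N$; $U\subset\mathbb R^\ell$ is compact with Lebesgue measure $\mathrm{Leb}(U)>0$; $\mathcal S=\{1,\dots,d\}$. For each $u\in U$, $p^u=(p^u_{ij})_{i,j\in\mathcal S}$ is a stochastic matrix and $p^u_i\in\mathbb R^d$ is its $i$-th row. $\mathcal P(U)$ is the set of Borel probability measures on $U$, $\mathcal D(U)$ the set of probability density functions on $U$ (w.r.t. Lebesgue measure, identified when a.e. equal). A relaxed feedback control is a map $\pi:\mathcal S\to\mathcal P(U)$; $\Pi$ is the set of all of them. Under $\pi$, $X^\pi=(X^\pi_k)_{k\in\mathbb N_0}$ is the $\mathcal S$-valued Markov chain such that, given $X_t=i$, an action $u$ is sampled from $\pi(i)$ and $X_{t+1}=j$ with probability $p^u_{ij}$ (so its transition probabilities are $\int_U p^u_{ij}\,\pi(i)(du)$). $\mathbb E_i$ is expectation given $X_0=i$. The reward is $f:[0,\infty)\times\mathcal S\times U\to\mathbb R$, and $f^\mu(t,i):=\int_U f(t,i,u)\mu(du)$ for $\mu\in\mathcal P(U)$. The maps $u\mapsto f(t,i,u)$ and $u\mapsto p^u_i$ are Borel measurable. The discount function $\delta:[0,\infty)\to[0,1]$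 is nonincreasing with $\delta(0)=1$. For $\rho\in\mathcal D(U)$, $\mathcal H(\rho):=-\int_U\ln(\rho(u))\rho(u)\,du$. $\Pi_r$ is the set of regular relaxed feedback controls: those $\pi\in\Pi$ such that each $\pi(i)$ has a density in $\mathcal D(U)$ (identified with $\pi(i)$) with $\mathcal H(\pi(i))>-\infty$. For $\lambda>0$, $\pi\in\Pi_r$, $i\in\mathcal S$: $$J^\pi_\lambda(i):=\mathbb E_i\Big[\sum_{k=0}^\infty\big(f^{\pi(X^\pi_k)}(k,X^\pi_k)+\lambda\delta(k)\mathcal H(\pi(X^\pi_k))\big)\Big],$$ $$V^\pi_\lambda(i):=\mathbb E_i\Big[\sum_{k=0}^\infty\big(f^{\pi(X^\pi_k)}(1+k,X^\pi_k)+\lambda\delta(1+k)\mathcal H(\pi(X^\pi_k))\big)\Big],$$ with $V^\pi_\lambda=(V^\pi_\lambda(1),\dots,V^\pi_\lambda(d))\in\mathbb R^d$. For $\pi,\pi'$, $\pi'\otimes_1\pi$ means using $\pi'$ at time $0$ and $\pi$ at all times $\ge1$ (both for sampling actions and for the reward/entropy terms); $J_\lambda^{\pi'\otimes_1\pi}$ is the corresponding value. $\pi\in\Pi_r$ is a regular relaxed equilibrium (for $J_\lambda$) if $J_\lambda^{\pi'\otimes_1\pi}(i)\le J_\lambda^\pi(i)$ for all $i\in\mathcal S$ and $\pi'\in\Pi_r$. $\Gamma_\lambda:\mathbb R^d\times\mathcal S\to\mathcal D(U)$ is $$\Gamma_\lambda(y,i)(u):=\frac{e^{\frac1\lambda(f(0,i,u)+p^u_i\cdot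 y)}}{\int_U e^{\frac1\lambda(f(0,i,v)+p^v_i\cdot y)}dv},$$ and $\Phi_\lambda:\Pi_r\to\Pi_r$ is $\Phi_\lambda(\pi):=\Gamma_\lambda(V^\pi_\lambda,\cdot)$. *)

theory Defs
  imports "HOL-Probability.Probability"
begin

text \<open>
  The state space is a finite type \<open>'d\<close>, so that \<open>d = CARD('d)\<close> and value vectors live in
  \<open>real^'d\<close>; actions live in \<open>real^'l\<close>. For an action \<open>u\<close>, \<open>p u\<close> is the transition matrix, with
  rows \<open>p u $ i\<close>.
\<close>

definition stochastic_matrix :: "real^'d^'d \<Rightarrow> bool" where
  "stochastic_matrix A \<longleftrightarrow> (\<forall>i j. 0 \<le> A $ i $ j) \<and> (\<forall>i. (\<Sum>j\<in>UNIV. A $ i $ j) = 1)"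

abbreviation leb :: "(real^'l) set \<Rightarrow> (real^'l) measure" where
  "leb U \<equiv> restrict_space lborel U"


subsection \<open>Densities, entropy and controls\<close>

definition densities :: "(real^'l) set \<Rightarrow> (real^'l \<Rightarrow> real) set" where
  "densities U = {\<rho> \<in> borel_measurable (leb U).
     (\<forall>u\<in>U. 0 \<le> \<rho> u) \<and> (\<integral>\<^sup>+u. ennreal (\<rho> u) \<partial>leb U) = 1}"

text \<open>
  The Bochner integral is \<open>0\<close> on non-integrable functions, which would hide the value \<open>-\<infinity>\<close> of the
  entropy, so the entropy uses the extended-valued Lebesgue integral. For \<open>U\<close> of finite measure
  the negative part of \<open>ln (\<rho> u) * \<rho> u\<close> is integrable, so \<open>\<infinity> - \<infinity>\<close> does not arise.
\<close>

definition ereal_integral :: "'a measure \<Rightarrow> ('a \<Rightarrow> real) \<Rightarrow> ereal" where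
  "ereal_integral M g =
     enn2ereal (\<integral>\<^sup>+x. ennreal (g x) \<partial>M) - enn2ereal (\<integral>\<^sup>+x. ennreal (- g x) \<partial>M)"

definition density_entropy :: "(real^'l) set \<Rightarrow> (real^'l \<Rightarrow> real) \<Rightarrow> ereal" where
  "density_entropy U \<rho> = - ereal_integral (leb U) (\<lambda>u. ln (\<rho> u) * \<rho> u)"

text \<open>
  \<open>relaxed_entropy\<close> is the entropy of a measure having a density; it is used only where that entropy
  is finite. By a.e. uniqueness of densities the version chosen by \<^const>\<open>RN_deriv\<close> is
  immaterial (lemma \<open>relaxed_entropy_density\<close>).
\<close>

definition relaxed_entropy :: "(real^'l) set \<Rightarrow> (real^'l) measure \<Rightarrow> real" where
  "relaxed_entropy U \<mu> =
     real_of_ereal (density_entropy U (\<lambda>u. enn2real (RN_deriv (leb U) \<mu> u)))"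

definition relaxed_controls :: "(real^'l) set \<Rightarrow> ('d \<Rightarrow> (real^'l) measure) set" where
  "relaxed_controls U = {\<pi>. \<forall>i. \<pi> i \<in> space (prob_algebra (restrict_space borel U))}"

definition regular_controls :: "(real^'l) set \<Rightarrow> ('d \<Rightarrow> (real^'l) measure) set" where
  "regular_controls U = {\<pi> \<in> relaxed_controls U.
     \<forall>i. \<exists>\<rho>\<in>densities U. \<pi> i = density (leb U) (\<lambda>u. ennreal (\<rho> u)) \<and> density_entropy U \<rho> > -\<infinity>}"

lemma relaxed_entropy_density:
  assumes U: "compact U" and \<rho>: "\<rho> \<in> densities U"
  shows "relaxed_entropy U (density (leb U) (\<lambda>u. ennreal (\<rho> u))) =
         real_of_ereal (density_entropy U \<rho>)"
proof -
  define \<nu> where "\<nu> = density (leb U) (\<lambda>u. ennreal (\<rho> u))"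
  have [measurable]: "\<rho> \<in> borel_measurable (leb U)" using \<rho> by (simp add: densities_def)
  have U': "U \<in> sets borel" using U by (simp add: compact_imp_closed borel_closed)
  have "emeasure lborel U < \<infinity>"
    using U emeasure_compact_finite by auto
  then interpret finite_measure "leb U"
    using U' by (auto intro!: finite_measureI simp: emeasure_restrict_space space_restrict_space)
  have "AE u in leb U. RN_deriv (leb U) \<nu> u = ennreal (\<rho> u)"
    using RN_deriv_unique[of "\<lambda>u. ennreal (\<rho> u)" \<nu>] by (auto simp: \<nu>_def elim!: AE_mp)
  moreover have "AE u in leb U. 0 \<le> \<rho> u"
    using \<rho> by (intro AE_I2) (auto simp: densities_def space_restrict_space)
  ultimately have "AE u in leb U. enn2real (RN_deriv (leb U) \<nu> u) = \<rho> u"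
    by eventually_elim simp
  then have "density_entropy U (\<lambda>u. enn2real (RN_deriv (leb U) \<nu> u)) = density_entropy U \<rho>"
    unfolding density_entropy_def ereal_integral_def
    by (intro arg_cong[of _ _ uminus] arg_cong2[of _ _ _ _ "(-)"] arg_cong[of _ _ enn2ereal]
        nn_integral_cong_AE) auto
  then show ?thesis by (simp add: relaxed_entropy_def \<nu>_def)
qed


subsection \<open>The controlled chain\<close>

text \<open>
  \<open>path_law q i\<close> is the law on path space of the Markov chain that starts in \<open>i\<close> and moves from
  time \<open>n\<close> to time \<open>Suc n\<close> according to \<open>q n\<close>, constructed by the Ionescu-Tulcea theorem from the
  conditional laws of the \<open>n\<close>-th coordinate given the previous ones.
\<close>

fun chain_kernel :: "(nat \<Rightarrow> 'd \<Rightarrow> 'd pmf) \<Rightarrow> 'd \<Rightarrow> nat \<Rightarrow> (nat \<Rightarrow> 'd) \<Rightarrow> 'd measure" where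
  "chain_kernel q i 0 \<omega> = return (count_space UNIV) i"
| "chain_kernel q i (Suc n) \<omega> = measure_pmf (q n (\<omega> n))"

global_interpretation chain: Ionescu_Tulcea "chain_kernel q i" "\<lambda>_. count_space UNIV"
  for q :: "nat \<Rightarrow> 'd::finite \<Rightarrow> 'd pmf" and i :: 'd
proof (rule Ionescu_Tulcea.intro)
  fix n :: nat
  show "chain_kernel q i n \<in> measurable (PiM {0..<n} (\<lambda>_. count_space UNIV))
          (subprob_algebra (count_space UNIV))"
  proof (cases n)
    case 0
    have "chain_kernel q i 0 = (\<lambda>_. return (count_space UNIV) i)"
      by (simp add: fun_eq_iff)
    then show ?thesis using 0 by (simp add: return_measurable[THEN measurable_space])
  next
    case (Suc m)
    have "chain_kernel q i (Suc m) = (\<lambda>x. measure_pmf (q m x)) \<circ> (\<lambda>\<omega>. \<omega> m)"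
      by (simp add: fun_eq_iff)
    moreover have "(\<lambda>x. measure_pmf (q m x)) \<in> measurable (count_space UNIV)
        (subprob_algebra (count_space UNIV))"
      by (simp add: space_subprob_algebra measure_pmf.subprob_space_axioms)
    ultimately show ?thesis
      using Suc by (simp only:) (rule measurable_comp[OF measurable_component_singleton], simp_all)
  qed
next
  show "prob_space (chain_kernel q i n \<omega>)"
    for n :: nat and \<omega> :: "nat \<Rightarrow> 'd"
    by (cases n) (auto simp: prob_space_return measure_pmf.prob_space_axioms)
qed

definition path_law :: "(nat \<Rightarrow> 'd::finite \<Rightarrow> 'd pmf) \<Rightarrow> 'd \<Rightarrow> (nat \<Rightarrow> 'd) measure" where
  "path_law q i = chain.PF.lim q i"

lemma prob_space_path_law: "prob_space (path_law q i)"
proof (rule prob_spaceI)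
  let ?M = "\<lambda>_::nat. count_space UNIV :: 'd measure"
  have "emeasure (chain.PF.lim q i) (chain.PF.emb UNIV {} {\<lambda>_. undefined}) =
        emeasure (chain.CI q i {}) {\<lambda>_. undefined}"
    by (rule chain.lim) (auto simp: PiM_empty)
  also have "\<dots> = 1"
    using prob_space.emeasure_space_1[OF chain.PF.prob_space_P[of "{}" q i]]
    by (simp add: chain.PF.space_P PiM_empty)
  also have "chain.PF.emb UNIV {} {\<lambda>_. undefined} = space (PiM UNIV ?M)"
    by (auto simp: prod_emb_def space_PiM)
  finally show "emeasure (path_law q i) (space (path_law q i)) = 1"
    by (simp add: path_law_def chain.PF.space_lim)
qed

lemma sets_path_law: "sets (path_law q i) = sets (PiM UNIV (\<lambda>_. count_space UNIV))"
  unfolding path_law_def by simp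

lemma path_law_cylinder:
  "emeasure (path_law q i) {\<omega>. \<forall>k\<le>n. \<omega> k = x k} =
   (if x 0 = i then \<Prod>k<n. ennreal (pmf (q k (x k)) (x (Suc k))) else 0)"
proof -
  let ?M = "\<lambda>_::nat. count_space UNIV :: 'd measure"
  define A where "A m = {restrict x {0..<m}}" for m
  have spc: "space (PiM {0..<m} ?M) = extensional {0..<m}" for m
    by (simp add: space_PiM PiE_def)
  have A[measurable]: "A m \<in> sets (PiM {0..<m} ?M)" for m
  proof -
    have "A m = PiE {0..<m} (\<lambda>k. {x k})"
      by (auto simp: A_def PiE_def Pi_def extensional_def restrict_def fun_eq_iff)
    then show ?thesis by (simp add: sets_PiM_I_finite)
  qed
  have step: "emeasure (chain.C q i 0 (Suc m) (\<lambda>_. undefined)) (A (Suc m)) =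
      emeasure (chain_kernel q i m x) {x m} * emeasure (chain.C q i 0 m (\<lambda>_. undefined)) (A m)" for m
  proof -
    let ?C = "chain.C q i 0 m (\<lambda>_. undefined)"
    have und: "(\<lambda>_. undefined) \<in> space (PiM {0..<0} ?M)" by simp
    have setsC: "sets ?C = sets (PiM {0..<m} ?M)" using chain.sets_C[OF und, of q i m] by simp
    have spC: "space ?C = space (PiM {0..<m} ?M)" using sets_eq_imp_space_eq[OF setsC] .
    have "emeasure (chain.C q i 0 (Suc m) (\<lambda>_. undefined)) (A (Suc m)) =
        (\<integral>\<^sup>+\<omega>. emeasure (chain.eP q i m \<omega>) (A (Suc m)) \<partial>?C)"
      using spC chain.space_C
      by (simp, subst emeasure_bind[where N="PiM {0..<Suc m} ?M"])
         (auto simp: measurable_cong_sets[OF setsC refl] chain.measurable_eP)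
    also have "\<dots> = (\<integral>\<^sup>+\<omega>. emeasure (chain_kernel q i m x) {x m} * indicator (A m) \<omega> \<partial>?C)"
    proof (rule nn_integral_cong)
      fix \<omega> assume "\<omega> \<in> space ?C"
      then have \<omega>: "\<omega> \<in> space (PiM {0..<m} ?M)" using spC by simp
      then have ext: "\<omega> \<in> extensional {0..<m}" unfolding spc .
      have eq: "fun_upd \<omega> m -` A (Suc m) = (if \<omega> \<in> A m then {x m} else {})"
      proof -
        have "(fun_upd \<omega> m y = restrict x {0..<Suc m}) \<longleftrightarrow> \<omega> = restrict x {0..<m} \<and> y = x m" for y
          using ext by (auto simp: fun_eq_iff extensional_def restrict_def less_Suc_eq)
        then show ?thesis by (auto simp: A_def)
      qed
      have ker: "chain_kernel q i m \<omega> = chain_kernel q i m x" if "\<omega> \<in> A m"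
        using that by (cases m) (auto simp: A_def)
      show "emeasure (chain.eP q i m \<omega>) (A (Suc m)) =
            emeasure (chain_kernel q i m x) {x m} * indicator (A m) \<omega>"
        using chain.emeasure_eP[OF \<omega> A, of q i] eq ker by (auto split: split_indicator)
    qed
    also have "\<dots> = emeasure (chain_kernel q i m x) {x m} * emeasure ?C (A m)"
      by (subst nn_integral_cmult_indicator) (auto simp: setsC)
    finally show ?thesis .
  qed
  have C: "emeasure (chain.C q i 0 (Suc m) (\<lambda>_. undefined)) (A (Suc m)) =
      (if x 0 = i then \<Prod>k<m. ennreal (pmf (q k (x k)) (x (Suc k))) else 0)" for m
  proof (induction m)
    case 0
    have "emeasure (chain.C q i 0 0 (\<lambda>_. undefined)) (A 0) = 1"
      using A[of 0] by (simp add: A_def restrict_def)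
    then show ?case by (simp only: step) (auto split: split_indicator)
  next
    case (Suc m)
    show ?case
      by (subst step, subst Suc.IH) (simp add: emeasure_pmf_single mult.commute)
  qed
  have "{\<omega>. \<forall>k\<le>n. \<omega> k = x k} = chain.PF.emb UNIV {0..<Suc n} (A (Suc n))"
    by (auto simp: prod_emb_def A_def space_PiM restrict_def fun_eq_iff less_Suc_eq_le) metis
  then have "emeasure (path_law q i) {\<omega>. \<forall>k\<le>n. \<omega> k = x k} = emeasure (chain.CI q i {0..<Suc n}) (A (Suc n))"
    unfolding path_law_def by (simp only: chain.lim[OF finite_atLeastLessThan A])
  also have "\<dots> = emeasure (chain.C q i 0 (Suc n) (\<lambda>_. undefined)) (A (Suc n))"
  proof -
    have "chain.PF.emb {0..<Suc n} {0..<Suc n} (A (Suc n)) = A (Suc n)"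
      using sets.sets_into_space[OF A] by (intro prod_emb_id) (auto simp: space_PiM)
    then show ?thesis using chain.emeasure_CI[OF subset_refl A, of q i "Suc n"] by simp
  qed
  finally show ?thesis by (simp only: C)
qed

text \<open>
  One step from state \<open>i\<close>: draw \<open>u\<close> from \<open>\<mu>\<close>, then move to \<open>j\<close> with probability \<open>p u $ i $ j\<close>.
\<close>

definition step_pmf :: "(real^'l \<Rightarrow> real^'d^'d) \<Rightarrow> (real^'l) measure \<Rightarrow> 'd \<Rightarrow> 'd::finite pmf" where
  "step_pmf p \<mu> i = embed_pmf (\<lambda>j. \<integral>u. p u $ i $ j \<partial>\<mu>)"

lemma pmf_step_pmf:
  assumes "\<And>u. u \<in> U \<Longrightarrow> stochastic_matrix (p u)"
    and meas: "(\<lambda>u. p u $ i) \<in> borel_measurable (restrict_space borel U)"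
    and \<mu>: "\<mu> \<in> space (prob_algebra (restrict_space borel U))"
  shows "pmf (step_pmf p \<mu> i) j = (\<integral>u. p u $ i $ j \<partial>\<mu>)"
proof -
  interpret prob_space \<mu> using \<mu> by (simp add: space_prob_algebra)
  have sets: "sets \<mu> = sets (restrict_space borel U)" using \<mu> by (simp add: space_prob_algebra)
  have sp: "space \<mu> = U" using sets_eq_imp_space_eq[OF sets] by (simp add: space_restrict_space)
  have m: "(\<lambda>u. p u $ i $ k) \<in> borel_measurable \<mu>" for k
    using measurable_compose[OF meas borel_measurable_continuous_onI[of "\<lambda>v. v $ k"]]
    by (simp add: measurable_cong_sets[OF sets refl] continuous_intros)
  have nn: "0 \<le> p u $ i $ k" and sum1: "(\<Sum>k\<in>UNIV. p u $ i $ k) = 1" if "u \<in> U" for u k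
    using assms(1)[OF that] by (auto simp: stochastic_matrix_def)
  have le1: "p u $ i $ k \<le> 1" if "u \<in> U" for u k
    using member_le_sum[of k UNIV "\<lambda>k. p u $ i $ k"] nn[OF that] sum1[OF that] by simp
  have int: "integrable \<mu> (\<lambda>u. p u $ i $ k)" for k
    by (rule integrable_const_bound[where B=1]) (use m nn le1 sp in auto)
  have ge: "0 \<le> (\<integral>u. p u $ i $ k \<partial>\<mu>)" for k
    by (rule integral_nonneg_AE) (use nn sp in auto)
  have "(\<Sum>k\<in>UNIV. \<integral>u. p u $ i $ k \<partial>\<mu>) = (\<integral>u. (\<Sum>k\<in>UNIV. p u $ i $ k) \<partial>\<mu>)"
    by (rule Bochner_Integration.integral_sum[symmetric]) (rule int)
  also have "\<dots> = (\<integral>u. 1 \<partial>\<mu>)"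
    by (rule Bochner_Integration.integral_cong) (use sum1 sp in auto)
  finally have "(\<Sum>k\<in>UNIV. \<integral>u. p u $ i $ k \<partial>\<mu>) = 1" by (simp add: prob_space)
  then have "(\<integral>\<^sup>+k. ennreal (\<integral>u. p u $ i $ k \<partial>\<mu>) \<partial>count_space UNIV) = 1"
    using ge by (simp add: nn_integral_count_space_finite sum_ennreal)
  then show ?thesis
    unfolding step_pmf_def using ge by (subst pmf_embed_pmf) auto
qed

text \<open>
  A Markov strategy \<open>\<sigma>\<close> uses the relaxed control \<open>\<sigma> k\<close> at time \<open>k\<close>; a control \<open>\<pi>\<close> is identified with
  the constant strategy, and \<open>paste1 \<pi>' \<pi>\<close> is the strategy using \<open>\<pi>'\<close> at time 0 only.
\<close>

definition controlled_law ::
    "(real^'l \<Rightarrow> real^'d^'d) \<Rightarrow> (nat \<Rightarrow> 'd \<Rightarrow> (real^'l) measure) \<Rightarrow> 'd::finite \<Rightarrow> (nat \<Rightarrow> 'd) measure"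
  where "controlled_law p \<sigma> i = path_law (\<lambda>k x. step_pmf p (\<sigma> k x) x) i"

definition paste1 :: "('d \<Rightarrow> 'm) \<Rightarrow> ('d \<Rightarrow> 'm) \<Rightarrow> nat \<Rightarrow> 'd \<Rightarrow> 'm" where
  "paste1 \<pi>' \<pi> = (\<lambda>k. if k = 0 then \<pi>' else \<pi>)"


subsection \<open>Values, equilibria and the policy iteration operator\<close>

definition relaxed_reward ::
    "(real \<Rightarrow> 'd \<Rightarrow> real^'l \<Rightarrow> real) \<Rightarrow> (real^'l) measure \<Rightarrow> real \<Rightarrow> 'd \<Rightarrow> real" where
  "relaxed_reward f \<mu> t i = (\<integral>u. f t i u \<partial>\<mu>)"

definition J_value ::
    "(real^'l) set \<Rightarrow> (real^'l \<Rightarrow> real^'d^'d) \<Rightarrow> (real \<Rightarrow> 'd \<Rightarrow> real^'l \<Rightarrow> real) \<Rightarrow> (real \<Rightarrow> real) \<Rightarrow> real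
     \<Rightarrow> (nat \<Rightarrow> 'd \<Rightarrow> (real^'l) measure) \<Rightarrow> 'd::finite \<Rightarrow> real" where
  "J_value U p f \<delta> lam \<sigma> i =
     (\<integral>X. (\<Sum>k. relaxed_reward f (\<sigma> k (X k)) (real k) (X k)
              + lam * \<delta> (real k) * relaxed_entropy U (\<sigma> k (X k))) \<partial>controlled_law p \<sigma> i)"

definition V_value ::
    "(real^'l) set \<Rightarrow> (real^'l \<Rightarrow> real^'d^'d) \<Rightarrow> (real \<Rightarrow> 'd \<Rightarrow> real^'l \<Rightarrow> real) \<Rightarrow> (real \<Rightarrow> real) \<Rightarrow> real
     \<Rightarrow> ('d \<Rightarrow> (real^'l) measure) \<Rightarrow> real^'d::finite" where
  "V_value U p f \<delta> lam \<pi> = (\<chi> i.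
     \<integral>X. (\<Sum>k. relaxed_reward f (\<pi> (X k)) (1 + real k) (X k)
             + lam * \<delta> (1 + real k) * relaxed_entropy U (\<pi> (X k))) \<partial>controlled_law p (\<lambda>_. \<pi>) i)"

definition regular_equilibrium ::
    "(real^'l) set \<Rightarrow> (real^'l \<Rightarrow> real^'d^'d) \<Rightarrow> (real \<Rightarrow> 'd \<Rightarrow> real^'l \<Rightarrow> real) \<Rightarrow> (real \<Rightarrow> real) \<Rightarrow> real
     \<Rightarrow> ('d::finite \<Rightarrow> (real^'l) measure) \<Rightarrow> bool" where
  "regular_equilibrium U p f \<delta> lam \<pi> \<longleftrightarrow> \<pi> \<in> regular_controls U \<and>
     (\<forall>i. \<forall>\<pi>'\<in>regular_controls U.
        J_value U p f \<delta> lam (paste1 \<pi>' \<pi>) i \<le> J_value U p f \<delta> lam (\<lambda>_. \<pi>) i)"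

definition gibbs_density ::
    "(real^'l) set \<Rightarrow> (real^'l \<Rightarrow> real^'d^'d) \<Rightarrow> (real \<Rightarrow> 'd \<Rightarrow> real^'l \<Rightarrow> real) \<Rightarrow> real
     \<Rightarrow> real^'d \<Rightarrow> 'd::finite \<Rightarrow> real^'l \<Rightarrow> real" where
  "gibbs_density U p f lam y i u =
     exp (1 / lam * (f 0 i u + p u $ i \<bullet> y)) /
     (\<integral>v. exp (1 / lam * (f 0 i v + p v $ i \<bullet> y)) \<partial>leb U)"

text \<open>
  Since controls are measures, the operator returns the measures whose densities are the Gibbs
  densities at \<open>y = V_value \<dots> \<pi>\<close>; equality of controls is a.e. equality of densities.
\<close>

definition Phi ::
    "(real^'l) set \<Rightarrow> (real^'l \<Rightarrow> real^'d^'d) \<Rightarrow> (real \<Rightarrow> 'd \<Rightarrow> real^'l \<Rightarrow> real) \<Rightarrow> (real \<Rightarrow> real) \<Rightarrow> real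
     \<Rightarrow> ('d::finite \<Rightarrow> (real^'l) measure) \<Rightarrow> 'd \<Rightarrow> (real^'l) measure" where
  "Phi U p f \<delta> lam \<pi> =
     (\<lambda>i. density (leb U) (\<lambda>u. ennreal (gibbs_density U p f lam (V_value U p f \<delta> lam \<pi>) i u)))"

end

theory Submission
  imports Defs
begin

text \<open>
  Conditioning on the first transition, the value of using \<open>\<pi>'\<close> once and then \<open>\<pi>\<close> from state \<open>i\<close> is
  \<open>\<integral> h d\<pi>'(i) + \<lambda> H(\<pi>'(i))\<close> with \<open>h u = f 0 i u + p u $ i \<bullet> V\<close>, where \<open>V\<close> is the auxiliary value of \<open>\<pi>\<close>.
  With the Gibbs density \<open>\<gamma> = exp (h / \<lambda>) / Z\<close> this equals \<open>\<lambda> ln Z - \<lambda> KL(\<pi>'(i) | \<gamma>)\<close>, so \<open>\<gamma>\<close> is the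
  unique maximiser up to null sets, and \<open>\<pi>\<close> cannot be improved iff each \<open>\<pi>(i)\<close> has density \<open>\<gamma>\<close>.
\<close>

section \<open>One-step analysis of the chain\<close>

text \<open>The law of the chain at time \<open>n\<close>. The recursion peels off the first
  transition rather than the last and shifts \<open>q\<close> in time, which matches the first-step
  decomposition below.\<close>

fun marginal_pmf :: "(nat \<Rightarrow> 'd \<Rightarrow> 'd pmf) \<Rightarrow> 'd \<Rightarrow> nat \<Rightarrow> 'd pmf" where
  "marginal_pmf q i 0 = return_pmf i"
| "marginal_pmf q i (Suc n) = bind_pmf (q 0 i) (\<lambda>j. marginal_pmf (\<lambda>k. q (Suc k)) j n)"

lemma space_path_law [simp]: "space (path_law q i) = UNIV"
  using sets_eq_imp_space_eq[OF sets_path_law, of q i] by (simp add: space_PiM)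

lemma measurable_path_law_component [measurable]:
  "(\<lambda>\<omega>. \<omega> k) \<in> measurable (path_law q i) (count_space UNIV)"
  unfolding measurable_cong_sets[OF sets_path_law refl] by measurable

text \<open>The Markov property at time \<open>n\<close> for a coordinate \<open>m\<close> steps
  later. \<open>n\<close> and \<open>x\<close> vary in the induction on \<open>m\<close>: each step
  lengthens the cylinder by one coordinate, sums over its value \<open>y\<close>, and leaves one
  transition fewer to go.\<close>

lemma emeasure_path_law_cylinder_Int_coordinate:
  "emeasure (path_law q i) {\<omega>. (\<forall>k\<le>n. \<omega> k = x k) \<and> \<omega> (n + m) = z} =
   emeasure (path_law q i) {\<omega>. \<forall>k\<le>n. \<omega> k = x k} *
   ennreal (pmf (marginal_pmf (\<lambda>k. q (n + k)) (x n) m) z)"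
proof (induction m arbitrary: n x)
  case 0
  have "{\<omega>. (\<forall>k\<le>n. \<omega> k = x k) \<and> \<omega> n = z} =
      (if x n = z then {\<omega>. \<forall>k\<le>n. \<omega> k = x k} else {})"
    by auto
  then show ?case by (simp add: indicator_def)
next
  case (Suc m)
  let ?M = "path_law q i"
  let ?x = "\<lambda>y. x(Suc n := y)"
  let ?D = "\<lambda>y. {\<omega>. (\<forall>k\<le>Suc n. \<omega> k = ?x y k) \<and> \<omega> (Suc n + m) = z}"
  let ?r = "\<lambda>y. pmf (marginal_pmf (\<lambda>k. q (Suc n + k)) y m) z"
  \<comment> \<open>Changing \<open>x\<close> at \<open>Suc n\<close> leaves the first
    \<open>n\<close> transition factors alone and appends the factor for the move to
    \<open>y\<close>.\<close>
  have cyl: "emeasure ?M {\<omega>. \<forall>k\<le>Suc n. \<omega> k = ?x y k} =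
      emeasure ?M {\<omega>. \<forall>k\<le>n. \<omega> k = x k} * ennreal (pmf (q n (x n)) y)" for y
  proof -
    have "(\<Prod>k<n. ennreal (pmf (q k (?x y k)) (?x y (Suc k)))) =
        (\<Prod>k<n. ennreal (pmf (q k (x k)) (x (Suc k))))"
      by (intro prod.cong) auto
    then show ?thesis by (simp add: path_law_cylinder)
  qed
  have "{\<omega> \<in> space ?M. (\<forall>k\<le>Suc n. \<omega> k = a k) \<and> \<omega> (Suc n + m) = z} \<in> sets ?M" for a
    by measurable
  then have D: "?D y \<in> sets ?M" for y by (simp only: space_path_law UNIV_I simp_thms)
  have "{\<omega>. (\<forall>k\<le>n. \<omega> k = x k) \<and> \<omega> (n + Suc m) = z} = (\<Union>y\<in>UNIV. ?D y)"
    by (auto simp: le_Suc_eq)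
  also have "emeasure ?M \<dots> = (\<Sum>y\<in>UNIV. emeasure ?M (?D y))"
  proof (rule sum_emeasure[symmetric])
    show "?D ` UNIV \<subseteq> sets ?M" using D by blast
    have "\<omega> (Suc n) = y" if "\<omega> \<in> ?D y" for \<omega> y using that by auto
    then show "disjoint_family_on ?D UNIV" unfolding disjoint_family_on_def by blast
  qed simp
  also have "\<dots> = (\<Sum>y\<in>UNIV. emeasure ?M {\<omega>. \<forall>k\<le>n. \<omega> k = x k} *
      ennreal (pmf (q n (x n)) y * ?r y))"
    by (simp only: Suc.IH cyl) (simp add: ennreal_mult mult.assoc)
  also have "\<dots> = emeasure ?M {\<omega>. \<forall>k\<le>n. \<omega> k = x k} *
      ennreal (\<Sum>y\<in>UNIV. pmf (q n (x n)) y * ?r y)"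
    by (simp add: sum_distrib_left[symmetric] sum_ennreal)
  also have "(\<Sum>y\<in>UNIV. pmf (q n (x n)) y * ?r y) =
      pmf (marginal_pmf (\<lambda>k. q (n + k)) (x n) (Suc m)) z"
    by (simp add: pmf_bind integral_measure_pmf[of UNIV])
  finally show ?case .
qed

text \<open>The starting cylinder \<open>\<omega> 0 = i\<close> has probability one, so intersecting
  with it changes nothing, and the previous lemma applies with \<open>n = 0\<close>.\<close>

lemma distr_path_law_coordinate:
  "distr (path_law q i) (count_space UNIV) (\<lambda>\<omega>. \<omega> m) = measure_pmf (marginal_pmf q i m)"
proof (rule measure_eqI_countable[of _ UNIV])
  fix z
  interpret prob_space "path_law q i" by (rule prob_space_path_law)
  have start: "emeasure (path_law q i) {\<omega>. \<omega> 0 = i} = 1"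
    using path_law_cylinder[of q i 0 "\<lambda>_. i"] by simp
  have "emeasure (path_law q i) {\<omega>. \<omega> m = z} =
      emeasure (path_law q i) {\<omega>. \<omega> 0 = i \<and> \<omega> m = z}"
  proof (rule emeasure_eq_AE)
    have "AE \<omega> in path_law q i. \<omega> \<in> {\<omega>. \<omega> 0 = i}"
    proof (rule AE_in_set_eq_1[THEN iffD2])
      have "{\<omega> \<in> space (path_law q i). \<omega> 0 = i} \<in> events" by measurable
      then show "{\<omega>. \<omega> 0 = i} \<in> events" by simp
      show "prob {\<omega>. \<omega> 0 = i} = 1" using start by (simp add: measure_def)
    qed
    then show "AE \<omega> in path_law q i. (\<omega> \<in> {\<omega>. \<omega> m = z}) = (\<omega> \<in> {\<omega>. \<omega> 0 = i \<and> \<omega> m = z})"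
      by eventually_elim simp
    have "{\<omega> \<in> space (path_law q i). \<omega> m = z} \<in> events" by measurable
    then show "{\<omega>. \<omega> m = z} \<in> events" by simp
    have "{\<omega> \<in> space (path_law q i). \<omega> 0 = i \<and> \<omega> m = z} \<in> events" by measurable
    then show "{\<omega>. \<omega> 0 = i \<and> \<omega> m = z} \<in> events" by simp
  qed
  also have "\<dots> = ennreal (pmf (marginal_pmf q i m) z)"
    using emeasure_path_law_cylinder_Int_coordinate[of q i 0 "\<lambda>_. i" m z] start by simp
  finally show "emeasure (distr (path_law q i) (count_space UNIV) (\<lambda>\<omega>. \<omega> m)) {z} =
      emeasure (measure_pmf (marginal_pmf q i m)) {z}"
    by (simp add: emeasure_distr emeasure_pmf_single vimage_def)
qed auto

lemma integral_path_law_coordinate: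
  fixes h :: "'d::finite \<Rightarrow> real"
  shows "(\<integral>X. h (X m) \<partial>path_law q i) = measure_pmf.expectation (marginal_pmf q i m) h"
  by (subst distr_path_law_coordinate[symmetric]) (simp add: integral_distr)

text \<open>The summable bound \<open>B\<close> justifies exchanging series and expectation; each
  term then involves one coordinate, hence only its marginal law.\<close>

lemma
  fixes g :: "nat \<Rightarrow> 'd::finite \<Rightarrow> real"
  assumes bound: "\<And>k x. \<bar>g k x\<bar> \<le> B k" and "summable B"
  shows integral_path_law_suminf:
      "(\<integral>X. (\<Sum>k. g k (X k)) \<partial>path_law q i) =
       (\<Sum>k. measure_pmf.expectation (marginal_pmf q i k) (g k))"
    and summable_marginal_expectation:
      "summable (\<lambda>k. measure_pmf.expectation (marginal_pmf q i k) (g k))"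
proof -
  interpret prob_space "path_law q i" by (rule prob_space_path_law)
  have meas: "(\<lambda>X. g k (X k)) \<in> borel_measurable (path_law q i)" for k
    by (rule measurable_compose[OF measurable_path_law_component]) simp
  have int: "integrable (path_law q i) (\<lambda>X. g k (X k))" for k
    by (rule integrable_const_bound[where B = "B k"]) (use bound meas in auto)
  have norm_le: "(\<integral>X. norm (g k (X k)) \<partial>path_law q i) \<le> B k" for k
  proof -
    have "(\<integral>X. norm (g k (X k)) \<partial>path_law q i) \<le> (\<integral>X. B k \<partial>path_law q i)"
      by (rule integral_mono) (use int bound in auto)
    then show ?thesis using prob_space by simp
  qed
  have "summable (\<lambda>k. norm (g k (X k)))" for X
    by (rule summable_comparison_test'[OF \<open>summable B\<close>, of 0]) (simp add: bound)
  then have sum_AE: "AE X in path_law q i. summable (\<lambda>k. norm (g k (X k)))" by simp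
  have sum_int: "summable (\<lambda>k. \<integral>X. norm (g k (X k)) \<partial>path_law q i)"
    by (rule summable_comparison_test'[OF \<open>summable B\<close>, of 0]) (use norm_le in simp)
  show "(\<integral>X. (\<Sum>k. g k (X k)) \<partial>path_law q i) =
       (\<Sum>k. measure_pmf.expectation (marginal_pmf q i k) (g k))"
    and "summable (\<lambda>k. measure_pmf.expectation (marginal_pmf q i k) (g k))"
    using integral_suminf[OF int sum_AE sum_int] sums_integral[OF int sum_AE sum_int]
    by (simp_all only: integral_path_law_coordinate sums_iff)
qed

text \<open>Once sum and expectation are exchanged only marginals occur, and these split at the
  first transition by definition.\<close>

lemma path_law_first_step:
  fixes g :: "nat \<Rightarrow> 'd::finite \<Rightarrow> real"
  assumes bound: "\<And>k x. \<bar>g k x\<bar> \<le> B k" and "summable B"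
  shows "(\<integral>X. (\<Sum>k. g k (X k)) \<partial>path_law q i) =
     g 0 i + (\<Sum>j\<in>UNIV. pmf (q 0 i) j *
       (\<integral>X. (\<Sum>k. g (Suc k) (X k)) \<partial>path_law (\<lambda>k. q (Suc k)) j))"
proof -
  let ?E = "\<lambda>j k. measure_pmf.expectation (marginal_pmf (\<lambda>k. q (Suc k)) j k) (g (Suc k))"
  have bound': "\<And>k x. \<bar>g (Suc k) x\<bar> \<le> B (Suc k)" and sum': "summable (\<lambda>k. B (Suc k))"
    using bound \<open>summable B\<close> by (auto simp: summable_Suc_iff)
  have "measure_pmf.expectation (marginal_pmf q i (Suc k)) (g (Suc k)) =
      (\<Sum>j\<in>UNIV. pmf (q 0 i) j * ?E j k)" for k
    by (simp add: integral_measure_pmf[of UNIV] pmf_bind sum_distrib_left sum_distrib_right mult_ac)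
       (rule sum.swap)
  \<comment> \<open>The term at \<open>k = 0\<close> is \<open>g 0 i\<close> because the marginal at
    time 0 is the point mass at \<open>i\<close>.\<close>
  then have "(\<Sum>k. measure_pmf.expectation (marginal_pmf q i k) (g k)) =
      g 0 i + (\<Sum>k. \<Sum>j\<in>UNIV. pmf (q 0 i) j * ?E j k)"
    using suminf_split_head[OF summable_marginal_expectation[of g B q i, OF bound \<open>summable B\<close>]]
    by (simp del: marginal_pmf.simps(2))
  also have "(\<Sum>k. \<Sum>j\<in>UNIV. pmf (q 0 i) j * ?E j k) = (\<Sum>j\<in>UNIV. pmf (q 0 i) j * (\<Sum>k. ?E j k))"
    using summable_marginal_expectation[OF bound' sum', of "\<lambda>k. q (Suc k)"]
    by (subst suminf_sum) (auto intro!: summable_mult sum.cong suminf_mult)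
  finally show ?thesis
    unfolding integral_path_law_suminf[of g B, OF bound \<open>summable B\<close>]
      integral_path_law_suminf[of "\<lambda>k. g (Suc k)", OF bound' sum'] .
qed


section \<open>The Gibbs variational principle\<close>

text \<open>This is \<open>ln (1 / x) \<le> 1 / x - 1\<close> multiplied by \<open>x\<close>; at
  \<open>x = 0\<close> the product is 0. It serves to bound the negative part of
  \<open>\<rho> ln \<rho>\<close> by 1.\<close>

lemma mult_ln_ge: "x * ln x \<ge> x - 1" if "x \<ge> 0" for x :: real
proof (cases "x = 0")
  case False
  then have "x > 0" using that by simp
  then have "x * ln (1 / x) \<le> x * (1 / x - 1)"
    using ln_le_minus_one[of "1 / x"] by (intro mult_left_mono) auto
  then show ?thesis using \<open>x > 0\<close> by (simp add: ln_div algebra_simps)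
qed simp

lemma ereal_integral_eq_integral:
  assumes "integrable M g"
  shows "ereal_integral M g = ereal (\<integral>x. g x \<partial>M)"
proof -
  have "(\<integral>\<^sup>+x. ennreal (g x) \<partial>M) < \<infinity>" "(\<integral>\<^sup>+x. ennreal (- g x) \<partial>M) < \<infinity>"
    using assms by (auto simp: real_integrable_def less_top)
  then obtain a b where "(\<integral>\<^sup>+x. ennreal (g x) \<partial>M) = ennreal a" "0 \<le> a"
      "(\<integral>\<^sup>+x. ennreal (- g x) \<partial>M) = ennreal b" "0 \<le> b"
    by (metis less_top_ennreal infinity_ennreal_def)
  then show ?thesis
    using real_lebesgue_integral_def[OF assms]
    by (simp add: ereal_integral_def enn2ereal_ennreal)
qed

context finite_measure
begin

text \<open>The negative part is at most 1, hence has finite integral on a finite measure; a value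
  below infinity then forces the positive part to be finite too.\<close>

lemma integrable_mult_ln_self:
  assumes [measurable]: "\<rho> \<in> borel_measurable M" and "\<And>x. x \<in> space M \<Longrightarrow> 0 \<le> \<rho> x"
    and "ereal_integral M (\<lambda>x. ln (\<rho> x) * \<rho> x) < \<infinity>"
  shows "integrable M (\<lambda>x. ln (\<rho> x) * \<rho> x)"
proof -
  have "- (ln (\<rho> x) * \<rho> x) \<le> 1" if "x \<in> space M" for x
    using mult_ln_ge[of "\<rho> x"] assms(2)[OF that] by (simp add: mult.commute)
  then have "(\<integral>\<^sup>+x. ennreal (- (ln (\<rho> x) * \<rho> x)) \<partial>M) \<le> (\<integral>\<^sup>+x. 1 \<partial>M)"
    by (intro nn_integral_mono) simp
  then have neg: "(\<integral>\<^sup>+x. ennreal (- (ln (\<rho> x) * \<rho> x)) \<partial>M) \<noteq> \<infinity>"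
    using emeasure_finite[of "space M"] by (auto simp: top_unique)
  then have "(\<integral>\<^sup>+x. ennreal (ln (\<rho> x) * \<rho> x) \<partial>M) \<noteq> \<infinity>"
    using assms(3) unfolding ereal_integral_def
    by (cases "\<integral>\<^sup>+x. ennreal (- (ln (\<rho> x) * \<rho> x)) \<partial>M") (auto simp: enn2ereal_ennreal)
  with neg show ?thesis by (simp add: real_integrable_def)
qed

lemma integrable_exp_bounded:
  fixes h :: "'a \<Rightarrow> real"
  assumes [measurable]: "h \<in> borel_measurable M"
    and bound: "\<And>x. x \<in> space M \<Longrightarrow> \<bar>h x\<bar> \<le> C" and "0 \<le> c"
  shows "integrable M (\<lambda>x. exp (c * h x))"
proof (rule integrable_const_bound)
  show "AE x in M. norm (exp (c * h x)) \<le> exp (c * C)"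
  proof (rule AE_I2)
    fix x assume "x \<in> space M"
    then have "c * h x \<le> c * C" using bound[of x] \<open>0 \<le> c\<close> by (intro mult_left_mono) auto
    then show "norm (exp (c * h x)) \<le> exp (c * C)" by simp
  qed
qed measurable

text \<open>A zero integral would make \<open>exp (g x)\<close> vanish almost everywhere, which
  positive total mass excludes.\<close>

lemma integral_exp_pos:
  fixes g :: "'a \<Rightarrow> real"
  assumes int: "integrable M (\<lambda>x. exp (g x))" and "0 < emeasure M (space M)"
  shows "0 < (\<integral>x. exp (g x) \<partial>M)"
proof -
  have "(\<integral>x. exp (g x) \<partial>M) \<noteq> 0"
  proof
    assume "(\<integral>x. exp (g x) \<partial>M) = 0"
    then have "AE x in M. exp (g x) = 0"
      by (subst (asm) integral_nonneg_eq_0_iff_AE[OF int]) auto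
    then have "AE x in M. False" by simp
    then show False
      using \<open>0 < emeasure M (space M)\<close> by (simp add: AE_iff_measurable[OF sets.top])
  qed
  moreover have "0 \<le> (\<integral>x. exp (g x) \<partial>M)" by (rule integral_nonneg_AE) simp
  ultimately show ?thesis by linarith
qed

text \<open>The Gibbs variational principle: integrating a pointwise nonnegative gap gives the
  inequality, and the pointwise equality case gives equality of the densities almost
  everywhere.\<close>

lemma
  fixes h :: "'a \<Rightarrow> real"
  assumes [measurable]: "h \<in> borel_measurable M" "\<rho> \<in> borel_measurable M"
    and bound: "\<And>x. x \<in> space M \<Longrightarrow> \<bar>h x\<bar> \<le> C"
    and "0 < emeasure M (space M)" and "0 < lam"
    and nonneg: "\<And>x. x \<in> space M \<Longrightarrow> 0 \<le> \<rho> x"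
    and mass: "(\<integral>\<^sup>+x. ennreal (\<rho> x) \<partial>M) = 1"
    and int_ln: "integrable M (\<lambda>x. ln (\<rho> x) * \<rho> x)"
  defines "Z \<equiv> (\<integral>x. exp (1 / lam * h x) \<partial>M)"
  shows gibbs_variational_le:
      "(\<integral>x. h x * \<rho> x \<partial>M) - lam * (\<integral>x. ln (\<rho> x) * \<rho> x \<partial>M) \<le> lam * ln Z"
    and gibbs_variational_eq_iff:
      "(\<integral>x. h x * \<rho> x \<partial>M) - lam * (\<integral>x. ln (\<rho> x) * \<rho> x \<partial>M) = lam * ln Z \<longleftrightarrow>
       (AE x in M. \<rho> x = exp (1 / lam * h x) / Z)"
proof -
  define \<gamma> where "\<gamma> x = exp (1 / lam * h x) / Z" for x
  have int_exp: "integrable M (\<lambda>x. exp (1 / lam * h x))"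
    by (rule integrable_exp_bounded) (use bound \<open>0 < lam\<close> in auto)
  then have "Z > 0" unfolding Z_def by (rule integral_exp_pos) fact
  then have \<gamma>_pos: "\<gamma> x > 0" for x by (simp add: \<gamma>_def)
  have ln_\<gamma>: "ln (\<gamma> x) = 1 / lam * h x - ln Z" for x
    using \<open>Z > 0\<close> by (simp add: \<gamma>_def ln_div)
  have int_\<gamma>: "integrable M \<gamma>" "(\<integral>x. \<gamma> x \<partial>M) = 1"
    using int_exp \<open>Z > 0\<close> unfolding \<gamma>_def[abs_def] by (simp_all add: Z_def)
  have int_\<rho>: "integrable M \<rho>"
    by (rule integrableI_nonneg) (use mass nonneg in simp_all)
  have mass': "(\<integral>x. \<rho> x \<partial>M) = 1"
    by (subst integral_eq_nn_integral) (use mass nonneg in simp_all)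
  have int_h: "integrable M (\<lambda>x. h x * \<rho> x)"
  proof (rule Bochner_Integration.integrable_bound[where f = "\<lambda>x. C * \<rho> x"])
    show "AE x in M. norm (h x * \<rho> x) \<le> norm (C * \<rho> x)"
    proof (rule AE_I2)
      fix x assume "x \<in> space M"
      then show "norm (h x * \<rho> x) \<le> norm (C * \<rho> x)"
        using bound[of x] by (simp add: abs_mult mult_right_mono)
    qed
  qed (use int_\<rho> in auto)
  \<comment> \<open>The pointwise gap \<open>\<gamma> - \<rho> - \<rho> ln (\<gamma> / \<rho>)\<close>: it is nonnegative, vanishes only for \<open>\<rho> = \<gamma>\<close>, and
    integrates to the relative entropy of \<open>\<rho>\<close> with respect to \<open>\<gamma>\<close>.\<close>
  define s where "s x = \<gamma> x - \<rho> x - ((1 / lam) * (h x * \<rho> x) - ln Z * \<rho> x - ln (\<rho> x) * \<rho> x)" for x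
  have int_s: "integrable M s"
    unfolding s_def using int_\<gamma> int_\<rho> int_h int_ln by auto
  \<comment> \<open>\<open>\<gamma>\<close> and \<open>\<rho>\<close> both have mass 1, so their
    contributions cancel and \<open>ln Z * \<rho>\<close> integrates to \<open>ln Z\<close>.\<close>
  have "(\<integral>x. s x \<partial>M) = ln Z - (1 / lam * (\<integral>x. h x * \<rho> x \<partial>M) - (\<integral>x. ln (\<rho> x) * \<rho> x \<partial>M))"
    unfolding s_def using int_\<gamma> int_\<rho> int_h int_ln by (simp add: mass')
  then have gap: "lam * (\<integral>x. s x \<partial>M) =
      lam * ln Z - ((\<integral>x. h x * \<rho> x \<partial>M) - lam * (\<integral>x. ln (\<rho> x) * \<rho> x \<partial>M))"
    using \<open>0 < lam\<close> by (simp add: field_simps)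
  have s: "0 \<le> s x \<and> (s x = 0 \<longleftrightarrow> \<rho> x = \<gamma> x)" if "x \<in> space M" for x
  proof (cases "\<rho> x = 0")
    \<comment> \<open>Here \<open>s x = \<gamma> x > 0\<close> and also
      \<open>\<rho> x \<noteq> \<gamma> x\<close>, so both sides of the equivalence are
      false.\<close>
    case True
    then show ?thesis using \<gamma>_pos[of x] by (simp add: s_def)
  next
    case False
    then have pos: "\<rho> x > 0" using nonneg[OF that] by simp
    have ln_ratio: "ln (\<gamma> x / \<rho> x) = 1 / lam * h x - ln Z - ln (\<rho> x)"
      using ln_\<gamma>[of x] ln_div[of "\<gamma> x" "\<rho> x"] pos \<gamma>_pos[of x] by simp
    \<comment> \<open>In the ratio \<open>r = \<gamma> x / \<rho> x\<close> the gap is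
      \<open>\<rho> x * (r - 1 - ln r)\<close>, and \<open>ln r \<le> r - 1\<close> has equality
      only at \<open>r = 1\<close>.\<close>
    have s_eq: "s x = \<rho> x * (\<gamma> x / \<rho> x - 1 - ln (\<gamma> x / \<rho> x))"
      unfolding ln_ratio s_def using pos by (simp add: algebra_simps)
    have "ln (\<gamma> x / \<rho> x) \<le> \<gamma> x / \<rho> x - 1"
      using pos \<gamma>_pos[of x] by (intro ln_le_minus_one) simp
    then have "0 \<le> s x" using pos by (simp add: s_eq)
    moreover have "\<rho> x = \<gamma> x" if "s x = 0"
    proof -
      have "ln (\<gamma> x / \<rho> x) = \<gamma> x / \<rho> x - 1" using that pos by (simp add: s_eq)
      then have "\<gamma> x / \<rho> x = 1" using pos \<gamma>_pos[of x] by (intro ln_eq_minus_one) auto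
      then show ?thesis using pos by simp
    qed
    moreover have "s x = 0" if "\<rho> x = \<gamma> x"
      using that pos by (simp add: s_eq)
    ultimately show ?thesis by blast
  qed
  have "0 \<le> (\<integral>x. s x \<partial>M)" using s by (intro integral_nonneg_AE AE_I2) auto
  then have "0 \<le> lam * (\<integral>x. s x \<partial>M)" using \<open>0 < lam\<close> by simp
  then show "(\<integral>x. h x * \<rho> x \<partial>M) - lam * (\<integral>x. ln (\<rho> x) * \<rho> x \<partial>M) \<le> lam * ln Z"
    unfolding gap by simp
  have "(\<integral>x. s x \<partial>M) = 0 \<longleftrightarrow> (AE x in M. s x = 0)"
    using s by (intro integral_nonneg_eq_0_iff_AE int_s AE_I2) auto
  also have "\<dots> \<longleftrightarrow> (AE x in M. \<rho> x = \<gamma> x)"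
    using s by (intro AE_cong) auto
  finally show "(\<integral>x. h x * \<rho> x \<partial>M) - lam * (\<integral>x. ln (\<rho> x) * \<rho> x \<partial>M) = lam * ln Z \<longleftrightarrow>
       (AE x in M. \<rho> x = exp (1 / lam * h x) / Z)"
    using gap \<open>0 < lam\<close> unfolding \<gamma>_def by auto
qed

end


section \<open>Equilibria as maximisers of the one-step problem\<close>

lemma finite_measure_leb: "compact U \<Longrightarrow> finite_measure (leb U)"
  using emeasure_compact_finite[of U]
  by (auto intro!: finite_measureI
      simp: emeasure_restrict_space space_restrict_space compact_imp_closed borel_closed)

text \<open>The series hypothesis is recast as a real summable sequence \<open>b\<close> that bounds
  both reward and discount at integer times, so that domination can be argued with real
  series.\<close>

locale control_problem =
  fixes U :: "(real^'l) set"
    and p :: "real^'l \<Rightarrow> real^'d^'d"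
    and f :: "real \<Rightarrow> 'd::finite \<Rightarrow> real^'l \<Rightarrow> real"
    and \<delta> :: "real \<Rightarrow> real"
    and lam :: real
    and b :: "nat \<Rightarrow> real"
  assumes U_compact: "compact U" and U_pos: "emeasure lborel U > 0"
    and p_stochastic: "\<And>u. u \<in> U \<Longrightarrow> stochastic_matrix (p u)"
    and p_measurable: "\<And>i. (\<lambda>u. p u $ i) \<in> borel_measurable (restrict_space borel U)"
    and f_measurable: "\<And>i. f 0 i \<in> borel_measurable (restrict_space borel U)"
    and \<delta>_0: "\<delta> 0 = 1"
    and lam_pos: "lam > 0"
    and f_bound: "\<And>k i u. u \<in> U \<Longrightarrow> \<bar>f (real k) i u\<bar> \<le> b k"
    and \<delta>_bound: "\<And>k. \<bar>\<delta> (real k)\<bar> \<le> b k"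
    and b_summable: "summable b"
begin

sublocale leb: finite_measure "leb U"
  by (rule finite_measure_leb[OF U_compact])

lemma U_sets: "U \<in> sets borel"
  using U_compact by (simp add: compact_imp_closed borel_closed)

lemma sets_leb: "sets (leb U) = sets (restrict_space borel U)"
  by (rule sets_restrict_space_cong) simp

lemma space_leb: "space (leb U) = U"
  by (simp add: space_restrict_space)

lemma emeasure_leb_pos: "emeasure (leb U) (space (leb U)) > 0"
  using U_pos U_sets by (simp add: emeasure_restrict_space space_restrict_space)

section \<open>The one-step objective and its Gibbs maximiser\<close>

definition gain :: "real^'d \<Rightarrow> 'd \<Rightarrow> real^'l \<Rightarrow> real" where
  "gain y i u = f 0 i u + p u $ i \<bullet> y"

text \<open>The entropy-regularised payoff of a single decision when the continuation values are
  \<open>y\<close>; \<open>gain\<close> plays the role of the Q-function.\<close>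

definition objective :: "real^'d \<Rightarrow> 'd \<Rightarrow> (real^'l) measure \<Rightarrow> real" where
  "objective y i \<mu> = (\<integral>u. gain y i u \<partial>\<mu>) + lam * relaxed_entropy U \<mu>"

definition partition_fn :: "real^'d \<Rightarrow> 'd \<Rightarrow> real" where
  "partition_fn y i = (\<integral>v. exp (1 / lam * gain y i v) \<partial>leb U)"

lemma gibbs_density_eq:
  "gibbs_density U p f lam y i u = exp (1 / lam * gain y i u) / partition_fn y i"
  by (simp add: gibbs_density_def gain_def partition_fn_def)

lemma gain_measurable [measurable]: "gain y i \<in> borel_measurable (leb U)"
  using p_measurable f_measurable
  unfolding gain_def[abs_def] measurable_cong_sets[OF sets_leb refl] by measurable

lemma p_nonneg: "u \<in> U \<Longrightarrow> 0 \<le> p u $ i $ j"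
  and p_sum: "u \<in> U \<Longrightarrow> (\<Sum>j\<in>UNIV. p u $ i $ j) = 1"
  using p_stochastic by (auto simp: stochastic_matrix_def)

lemma gain_bound: "\<bar>gain y i u\<bar> \<le> b 0 + norm y" if "u \<in> U"
proof -
  \<comment> \<open>A row is a probability vector, so its l1 norm is 1 and dominates the Euclidean
    norm used in Cauchy-Schwarz.\<close>
  have "norm (p u $ i) \<le> (\<Sum>j\<in>UNIV. \<bar>p u $ i $ j\<bar>)" by (rule norm_le_l1_cart)
  also have "\<dots> = 1" using p_nonneg[OF that] p_sum[OF that] by simp
  finally have "norm (p u $ i) * norm y \<le> 1 * norm y" by (intro mult_right_mono) auto
  then have "\<bar>p u $ i \<bullet> y\<bar> \<le> norm y"
    using Cauchy_Schwarz_ineq2[of "p u $ i" y] by simp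
  then show ?thesis using f_bound[OF that, of 0 i] by (simp add: gain_def)
qed

text \<open>Entropy above -\<infinity> turns the extended-valued integral into a Bochner integral,
  so that later computations are linear and real-valued.\<close>

lemma regular_controlE:
  assumes "\<pi> \<in> regular_controls U"
  obtains \<rho> where "\<rho> \<in> densities U" "\<pi> i = density (leb U) (\<lambda>u. ennreal (\<rho> u))"
    "integrable (leb U) (\<lambda>u. ln (\<rho> u) * \<rho> u)"
    "relaxed_entropy U (\<pi> i) = - (\<integral>u. ln (\<rho> u) * \<rho> u \<partial>leb U)"
proof -
  obtain \<rho> where \<rho>: "\<rho> \<in> densities U" "\<pi> i = density (leb U) (\<lambda>u. ennreal (\<rho> u))"
      "density_entropy U \<rho> > -\<infinity>"
    using assms by (auto simp: regular_controls_def)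
  have "ereal_integral (leb U) (\<lambda>u. ln (\<rho> u) * \<rho> u) < \<infinity>"
    using \<rho>(3) unfolding density_entropy_def
    by (cases "ereal_integral (leb U) (\<lambda>u. ln (\<rho> u) * \<rho> u)") simp_all
  then have int: "integrable (leb U) (\<lambda>u. ln (\<rho> u) * \<rho> u)"
    using \<rho>(1) by (intro leb.integrable_mult_ln_self) (simp_all add: densities_def space_leb)
  have "relaxed_entropy U (\<pi> i) = - (\<integral>u. ln (\<rho> u) * \<rho> u \<partial>leb U)"
    using relaxed_entropy_density[OF U_compact \<rho>(1)] \<rho>(2)
    by (simp add: density_entropy_def ereal_integral_eq_integral[OF int])
  with \<rho> int show thesis using that by blast
qed

text \<open>\<open>gain\<close> is bounded on \<open>U\<close>, hence so is the logarithm of the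
  Gibbs density; with \<open>D\<close> as that bound, the entropy integrand is dominated by
  \<open>D\<close> times a density of mass 1.\<close>

lemma gibbs_density_in_densities: "gibbs_density U p f lam y i \<in> densities U"
  and gibbs_density_entropy: "density_entropy U (gibbs_density U p f lam y i) > -\<infinity>"
proof -
  let ?\<gamma> = "gibbs_density U p f lam y i"
  let ?e = "\<lambda>u. exp (1 / lam * gain y i u)"
  have int_e: "integrable (leb U) ?e"
    by (rule leb.integrable_exp_bounded[where C = "b 0 + norm y"])
       (use gain_bound lam_pos in \<open>simp_all add: space_leb\<close>)
  then have Z: "partition_fn y i > 0"
    unfolding partition_fn_def by (rule leb.integral_exp_pos) (rule emeasure_leb_pos)
  have meas [measurable]: "?\<gamma> \<in> borel_measurable (leb U)"
    unfolding gibbs_density_eq[abs_def] by measurable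
  have pos: "?\<gamma> u > 0" for u using Z by (simp add: gibbs_density_eq)
  have int: "integrable (leb U) ?\<gamma>" "(\<integral>u. ?\<gamma> u \<partial>leb U) = 1"
    using int_e Z unfolding gibbs_density_eq[abs_def] by (simp_all add: partition_fn_def)
  have "(\<integral>\<^sup>+u. ennreal (?\<gamma> u) \<partial>leb U) = 1"
    using nn_integral_eq_integral[OF int(1)] int(2) pos by (simp add: less_imp_le)
  then show "?\<gamma> \<in> densities U" using meas pos by (auto simp: densities_def less_imp_le)
  have ln_\<gamma>: "ln (?\<gamma> u) = 1 / lam * gain y i u - ln (partition_fn y i)" for u
    using Z by (simp add: gibbs_density_eq ln_div)
  define D where "D = 1 / lam * (b 0 + norm y) + \<bar>ln (partition_fn y i)\<bar>"
  have "integrable (leb U) (\<lambda>u. ln (?\<gamma> u) * ?\<gamma> u)"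
  proof (rule Bochner_Integration.integrable_bound[where f = "\<lambda>u. D * ?\<gamma> u"])
    show "AE u in leb U. norm (ln (?\<gamma> u) * ?\<gamma> u) \<le> norm (D * ?\<gamma> u)"
    proof (rule AE_I2)
      fix u assume "u \<in> space (leb U)"
      then have "\<bar>gain y i u\<bar> \<le> b 0 + norm y" using gain_bound by (simp add: space_leb)
      then have "1 / lam * \<bar>gain y i u\<bar> \<le> 1 / lam * (b 0 + norm y)"
        using lam_pos by (intro mult_left_mono) auto
      moreover have "\<bar>ln (?\<gamma> u)\<bar> \<le> \<bar>1 / lam * gain y i u\<bar> + \<bar>ln (partition_fn y i)\<bar>"
        unfolding ln_\<gamma> by (rule abs_triangle_ineq4)
      ultimately have "\<bar>ln (?\<gamma> u)\<bar> \<le> D" using lam_pos by (simp add: D_def abs_mult)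
      then show "norm (ln (?\<gamma> u) * ?\<gamma> u) \<le> norm (D * ?\<gamma> u)"
        by (simp add: abs_mult mult_right_mono)
    qed
  qed (use int in auto)
  then show "density_entropy U ?\<gamma> > -\<infinity>"
    by (simp add: density_entropy_def ereal_integral_eq_integral)
qed

lemma density_in_prob_algebra:
  assumes "\<rho> \<in> densities U"
  shows "density (leb U) (\<lambda>u. ennreal (\<rho> u)) \<in> space (prob_algebra (restrict_space borel U))"
proof -
  have [measurable]: "\<rho> \<in> borel_measurable (leb U)" using assms by (simp add: densities_def)
  have "emeasure (density (leb U) (\<lambda>u. ennreal (\<rho> u))) (space (leb U)) =
      (\<integral>\<^sup>+u. ennreal (\<rho> u) \<partial>leb U)"
    by (subst emeasure_density) (auto intro!: nn_integral_cong)
  also have "\<dots> = 1" using assms by (simp add: densities_def)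
  finally have "emeasure (density (leb U) (\<lambda>u. ennreal (\<rho> u))) (space (leb U)) = 1" .
  then show ?thesis
    by (auto simp: space_prob_algebra sets_leb intro!: prob_spaceI)
qed

lemma Phi_regular: "Phi U p f \<delta> lam \<pi> \<in> regular_controls U"
  using gibbs_density_in_densities gibbs_density_entropy density_in_prob_algebra
  by (auto simp: regular_controls_def relaxed_controls_def Phi_def)

text \<open>Transfers the variational principle from densities to measures: uniqueness of densities
  turns equality almost everywhere into equality of measures, the sense in which \<open>Phi\<close>
  has a fixed point.\<close>

lemma
  assumes "\<pi> \<in> regular_controls U"
  shows objective_le: "objective y i (\<pi> i) \<le> lam * ln (partition_fn y i)"
    and objective_eq_iff: "objective y i (\<pi> i) = lam * ln (partition_fn y i) \<longleftrightarrow>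
      \<pi> i = density (leb U) (\<lambda>u. ennreal (gibbs_density U p f lam y i u))"
proof -
  obtain \<rho> where \<rho>: "\<rho> \<in> densities U"
      and \<pi>: "\<pi> i = density (leb U) (\<lambda>u. ennreal (\<rho> u))"
      and int: "integrable (leb U) (\<lambda>u. ln (\<rho> u) * \<rho> u)"
      and ent: "relaxed_entropy U (\<pi> i) = - (\<integral>u. ln (\<rho> u) * \<rho> u \<partial>leb U)"
    by (rule regular_controlE[OF assms])
  have meas [measurable]: "\<rho> \<in> borel_measurable (leb U)"
    and nonneg: "\<And>u. u \<in> space (leb U) \<Longrightarrow> 0 \<le> \<rho> u"
    and mass: "(\<integral>\<^sup>+u. ennreal (\<rho> u) \<partial>leb U) = 1"
    using \<rho> by (auto simp: densities_def space_leb)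
  have [measurable]: "gibbs_density U p f lam y i \<in> borel_measurable (leb U)"
    and nonneg': "\<And>u. u \<in> space (leb U) \<Longrightarrow> 0 \<le> gibbs_density U p f lam y i u"
    using gibbs_density_in_densities by (auto simp: densities_def space_leb)
  have bound: "\<And>u. u \<in> space (leb U) \<Longrightarrow> \<bar>gain y i u\<bar> \<le> b 0 + norm y"
    using gain_bound by (simp add: space_leb)
  \<comment> \<open>\<open>ent\<close> is applied while \<open>\<pi> i\<close> is still folded; only
    then is \<open>\<pi> i\<close> replaced by its density form.\<close>
  have obj: "objective y i (\<pi> i) =
      (\<integral>u. gain y i u * \<rho> u \<partial>leb U) - lam * (\<integral>u. ln (\<rho> u) * \<rho> u \<partial>leb U)"
    using nonneg by (simp add: objective_def ent) (simp add: \<pi> integral_density mult.commute)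
  show "objective y i (\<pi> i) \<le> lam * ln (partition_fn y i)"
    unfolding obj partition_fn_def
    by (rule leb.gibbs_variational_le[OF gain_measurable meas bound emeasure_leb_pos lam_pos
          nonneg mass int])
  have "objective y i (\<pi> i) = lam * ln (partition_fn y i) \<longleftrightarrow>
      (AE u in leb U. \<rho> u = gibbs_density U p f lam y i u)"
    unfolding obj partition_fn_def gibbs_density_eq
    by (rule leb.gibbs_variational_eq_iff[OF gain_measurable meas bound emeasure_leb_pos lam_pos
          nonneg mass int])
  also have "\<dots> \<longleftrightarrow> (AE u in leb U. ennreal (\<rho> u) = ennreal (gibbs_density U p f lam y i u))"
    using nonneg nonneg' by (intro AE_cong) simp
  also have "\<dots> \<longleftrightarrow> \<pi> i = density (leb U) (\<lambda>u. ennreal (gibbs_density U p f lam y i u))"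
    unfolding \<pi> by (intro leb.density_unique_iff[symmetric]) measurable
  finally show "objective y i (\<pi> i) = lam * ln (partition_fn y i) \<longleftrightarrow>
      \<pi> i = density (leb U) (\<lambda>u. ennreal (gibbs_density U p f lam y i u))" .
qed

section \<open>Expected rewards and the value of a one-time deviation\<close>

lemma relaxed_reward_bound:
  assumes "\<mu> \<in> space (prob_algebra (restrict_space borel U))"
  shows "\<bar>relaxed_reward f \<mu> (real k) i\<bar> \<le> b k"
proof -
  interpret prob_space \<mu> using assms by (simp add: space_prob_algebra)
  have "sets \<mu> = sets (restrict_space borel U)" using assms by (simp add: space_prob_algebra)
  then have sp: "space \<mu> = U" by (auto dest: sets_eq_imp_space_eq simp: space_restrict_space)
  have b: "0 \<le> b k" using \<delta>_bound[of k] by simp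
  have "norm (\<integral>u. f (real k) i u \<partial>\<mu>) \<le> b k"
  proof (cases "integrable \<mu> (f (real k) i)")
    case True
    have "norm (\<integral>u. f (real k) i u \<partial>\<mu>) \<le> (\<integral>u. norm (f (real k) i u) \<partial>\<mu>)"
      by (rule integral_norm_bound)
    also have "\<dots> \<le> (\<integral>u. b k \<partial>\<mu>)"
      by (rule integral_mono) (use True f_bound sp in auto)
    finally show ?thesis by (simp add: prob_space)
  \<comment> \<open>A non-integrable function has Bochner integral 0, which lies below the
    nonnegative \<open>b k\<close>.\<close>
  qed (use b in \<open>simp add: not_integrable_integral_eq\<close>)
  then show ?thesis by (simp add: relaxed_reward_def)
qed

text \<open>The weights of \<open>step_pmf\<close> are the averages of \<open>p u $ i $ j\<close>,
  so by linearity the averaged inner product is the mean of \<open>y\<close> after one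
  transition.\<close>

lemma integral_gain:
  assumes "\<mu> \<in> space (prob_algebra (restrict_space borel U))"
  shows "(\<integral>u. gain y i u \<partial>\<mu>) =
    relaxed_reward f \<mu> 0 i + (\<Sum>j\<in>UNIV. pmf (step_pmf p \<mu> i) j * y $ j)"
proof -
  interpret prob_space \<mu> using assms by (simp add: space_prob_algebra)
  have sets: "sets \<mu> = sets (restrict_space borel U)" using assms by (simp add: space_prob_algebra)
  then have sp: "space \<mu> = U" by (auto dest: sets_eq_imp_space_eq simp: space_restrict_space)
  have [measurable]: "f 0 i \<in> borel_measurable \<mu>" "(\<lambda>u. p u $ i) \<in> borel_measurable \<mu>"
    using f_measurable p_measurable by (simp_all add: measurable_cong_sets[OF sets refl])
  have int_f: "integrable \<mu> (f 0 i)"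
    by (rule integrable_const_bound[where B = "b 0"]) (use f_bound[of _ 0] sp in auto)
  have "\<bar>p u $ i $ j\<bar> \<le> 1" if "u \<in> U" for u j
    using member_le_sum[of j UNIV "\<lambda>k. p u $ i $ k"] p_nonneg[OF that] p_sum[OF that] by simp
  moreover have "(\<lambda>u. p u $ i $ j) \<in> borel_measurable \<mu>" for j
    by (rule measurable_compose[of "\<lambda>u. p u $ i" _ borel "\<lambda>v. v $ j"])
       (auto intro!: borel_measurable_continuous_onI continuous_intros)
  ultimately have int_p: "integrable \<mu> (\<lambda>u. p u $ i $ j)" for j
    by (intro integrable_const_bound[where B = 1]) (use sp in auto)
  show ?thesis
    using int_f int_p
    by (simp add: gain_def[abs_def] relaxed_reward_def inner_vec_def
        pmf_step_pmf[OF p_stochastic p_measurable assms])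
qed

text \<open>Only the time-0 term and the first transition depend on \<open>\<pi>'\<close>; from time 1 on, the chain
  follows \<open>\<pi>\<close> with time shifted by one, so the continuation value is \<^const>\<open>V_value\<close>.\<close>

lemma J_value_paste1:
  assumes "\<pi>' \<in> relaxed_controls U" and "\<pi> \<in> relaxed_controls U"
  shows "J_value U p f \<delta> lam (paste1 \<pi>' \<pi>) i = objective (V_value U p f \<delta> lam \<pi>) i (\<pi>' i)"
proof -
  let ?\<sigma> = "paste1 \<pi>' \<pi>"
  let ?H = "\<lambda>\<mu>. relaxed_entropy U \<mu>"
  define g where "g k x = relaxed_reward f (?\<sigma> k x) (real k) x + lam * \<delta> (real k) * ?H (?\<sigma> k x)" for k x
  \<comment> \<open>Finiteness of the state space gives one bound for all entropies of both
    controls: the sum of their absolute values.\<close>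
  define C where "C = (\<Sum>x\<in>UNIV. \<bar>?H (\<pi>' x)\<bar> + \<bar>?H (\<pi> x)\<bar>)"
  have \<sigma>: "?\<sigma> k x \<in> space (prob_algebra (restrict_space borel U))" for k x
    using assms by (auto simp: paste1_def relaxed_controls_def)
  have H: "\<bar>?H (?\<sigma> k x)\<bar> \<le> C" for k x
  proof -
    have "\<bar>?H (\<pi>' x)\<bar> + \<bar>?H (\<pi> x)\<bar> \<le> C"
      unfolding C_def by (rule member_le_sum[of x UNIV "\<lambda>x. \<bar>?H (\<pi>' x)\<bar> + \<bar>?H (\<pi> x)\<bar>"]) auto
    then show ?thesis by (auto simp: paste1_def)
  qed
  have bound: "\<bar>g k x\<bar> \<le> b k + lam * b k * C" for k x
  proof -
    have "\<bar>lam * \<delta> (real k) * ?H (?\<sigma> k x)\<bar> \<le> lam * b k * C"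
      unfolding abs_mult using lam_pos H[of k x] \<delta>_bound[of k]
      by (intro mult_mono) auto
    then show ?thesis
      using relaxed_reward_bound[OF \<sigma>, of k x k x]
        abs_triangle_ineq[of "relaxed_reward f (?\<sigma> k x) (real k) x" "lam * \<delta> (real k) * ?H (?\<sigma> k x)"]
      unfolding g_def by linarith
  qed
  have summ: "summable (\<lambda>k. b k + lam * b k * C)"
    using b_summable by (intro summable_add summable_mult summable_mult2)
  \<comment> \<open>At time \<open>Suc k\<close> the pasted strategy is \<open>\<pi>\<close> and
    \<open>real (Suc k) = 1 + real k\<close>, which is the time shift built into
    \<open>V_value\<close>.\<close>
  have tail: "(\<integral>X. (\<Sum>k. g (Suc k) (X k))
      \<partial>path_law (\<lambda>k x. step_pmf p (?\<sigma> (Suc k) x) x) j) = V_value U p f \<delta> lam \<pi> $ j" for j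
    by (simp add: V_value_def g_def paste1_def controlled_law_def)
  have "J_value U p f \<delta> lam ?\<sigma> i =
      (\<integral>X. (\<Sum>k. g k (X k)) \<partial>path_law (\<lambda>k x. step_pmf p (?\<sigma> k x) x) i)"
    by (simp add: J_value_def controlled_law_def g_def)
  also have "\<dots> = g 0 i + (\<Sum>j\<in>UNIV. pmf (step_pmf p (?\<sigma> 0 i) i) j * V_value U p f \<delta> lam \<pi> $ j)"
    by (subst path_law_first_step[OF bound summ]) (simp only: tail)
  \<comment> \<open>\<open>\<delta> 0 = 1\<close> gives the entropy at time 0 exactly the weight
    \<open>lam\<close>.\<close>
  also have "\<dots> = objective (V_value U p f \<delta> lam \<pi>) i (\<pi>' i)"
    using assms(1)
    by (subst objective_def, subst integral_gain)
       (auto simp: relaxed_controls_def g_def paste1_def \<delta>_0)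
  finally show ?thesis .
qed

text \<open>The continuation values come from \<open>\<pi>\<close> alone and stay fixed while
  \<open>\<pi>'\<close> varies, so equilibrium is a separate maximisation in each state.\<close>

theorem regular_equilibrium_iff:
  assumes \<pi>: "\<pi> \<in> regular_controls U"
  shows "regular_equilibrium U p f \<delta> lam \<pi> \<longleftrightarrow> Phi U p f \<delta> lam \<pi> = \<pi>"
proof -
  let ?y = "V_value U p f \<delta> lam \<pi>"
  have paste: "J_value U p f \<delta> lam (paste1 \<pi>' \<pi>) i = objective ?y i (\<pi>' i)"
    if "\<pi>' \<in> regular_controls U" for \<pi>' i
    using that \<pi> by (intro J_value_paste1) (auto simp: regular_controls_def)
  moreover have "paste1 \<pi> \<pi> = (\<lambda>_. \<pi>)" by (simp add: paste1_def fun_eq_iff)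
  ultimately have stay: "J_value U p f \<delta> lam (\<lambda>_. \<pi>) i = objective ?y i (\<pi> i)" for i
    using \<pi> by metis
  have Phi_opt: "objective ?y i (Phi U p f \<delta> lam \<pi> i) = lam * ln (partition_fn ?y i)" for i
    by (subst objective_eq_iff[OF Phi_regular]) (simp add: Phi_def)
  have "regular_equilibrium U p f \<delta> lam \<pi> \<longleftrightarrow>
      (\<forall>i. \<forall>\<pi>'\<in>regular_controls U. objective ?y i (\<pi>' i) \<le> objective ?y i (\<pi> i))"
    using \<pi> paste stay by (auto simp: regular_equilibrium_def)
  \<comment> \<open>\<open>Phi U p f \<delta> lam \<pi>\<close> is itself an admissible deviation
    and reaches the upper bound in every state, so being maximal is the same as reaching that
    bound.\<close>
  also have "\<dots> \<longleftrightarrow> (\<forall>i. objective ?y i (\<pi> i) = lam * ln (partition_fn ?y i))"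
    using objective_le[OF \<pi>] objective_le[of _ ?y] Phi_opt Phi_regular by (metis order_antisym)
  also have "\<dots> \<longleftrightarrow> Phi U p f \<delta> lam \<pi> = \<pi>"
    unfolding objective_eq_iff[OF \<pi>] by (auto simp: Phi_def fun_eq_iff)
  finally show ?thesis .
qed

end

section \<open>From the extended-valued series to real summable bounds\<close>

theorem proposition2p1:
  fixes U :: "(real^'l) set"
    and p :: "real^'l \<Rightarrow> real^'d^'d"
    and f :: "real \<Rightarrow> 'd \<Rightarrow> real^'l \<Rightarrow> real"
    and \<delta> :: "real \<Rightarrow> real"
    and lam :: real
    and \<pi> :: "'d \<Rightarrow> (real^'l) measure"
  assumes "compact U" and "emeasure lborel U > 0"
    and "\<And>u. u \<in> U \<Longrightarrow> stochastic_matrix (p u)"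
    and "\<And>i. (\<lambda>u. p u $ i) \<in> borel_measurable (restrict_space borel U)"
    and "\<And>t i. t \<ge> 0 \<Longrightarrow> f t i \<in> borel_measurable (restrict_space borel U)"
    and "\<And>t. t \<ge> 0 \<Longrightarrow> \<delta> t \<in> {0..1}" and "antimono_on {0..} \<delta>" and "\<delta> 0 = 1"
    and "(\<Sum>t. (SUP (i, u)\<in>UNIV \<times> U. ennreal \<bar>f (real t) i u\<bar>) + ennreal (\<delta> (real t))) < \<infinity>"
    and "lam > 0"
    and "\<pi> \<in> regular_controls U"
  shows "regular_equilibrium U p f \<delta> lam \<pi> \<longleftrightarrow> Phi U p f \<delta> lam \<pi> = \<pi>"
proof -
  define a where "a t = (SUP (i, u)\<in>UNIV \<times> U. ennreal \<bar>f (real t) i u\<bar>) + ennreal (\<delta> (real t))" for t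
  have sum_a: "(\<Sum>t. a t) \<noteq> \<top>" using assms(9) unfolding a_def by simp
  \<comment> \<open>Each term of a series with finite sum is finite; this matters because
    \<open>enn2real\<close> sends \<top> to 0, which would break the bounds.\<close>
  have fin: "a t < \<top>" for t
  proof -
    have "a t = (\<Sum>k\<in>{t}. a k)" by simp
    also have "\<dots> \<le> (\<Sum>k. a k)" by (rule sum_le_suminf) auto
    also have "\<dots> < \<top>" using sum_a by (simp add: less_top)
    finally show ?thesis .
  qed
  have le_a: "x \<le> enn2real (a t)" if "ennreal x \<le> a t" "0 \<le> x" for x t
    using enn2real_mono[OF that(1) fin] that(2) by simp
  have "summable (\<lambda>t. enn2real (a t))"
    using sum_a fin by (intro summable_suminf_not_top) auto
  moreover have "\<bar>f (real k) i u\<bar> \<le> enn2real (a k)" if "u \<in> U" for k i u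
  proof (rule le_a)
    have "ennreal \<bar>f (real k) i u\<bar> \<le> (SUP (i, u)\<in>UNIV \<times> U. ennreal \<bar>f (real k) i u\<bar>)"
      using that by (intro SUP_upper2[of "(i, u)"]) auto
    also have "\<dots> \<le> a k" by (simp add: a_def)
    finally show "ennreal \<bar>f (real k) i u\<bar> \<le> a k" .
  qed simp
  moreover have "\<bar>\<delta> (real k)\<bar> \<le> enn2real (a k)" for k
    using assms(6)[of "real k"] by (intro le_a) (simp_all add: a_def)
  ultimately interpret control_problem U p f \<delta> lam "\<lambda>t. enn2real (a t)"
    using assms by unfold_locales auto
  show ?thesis by (rule regular_equilibrium_iff[OF assms(11)])
qed

end
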